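(* Let $(\mathcal T(n))_{n\in\mathbb N}$ be the triangle Markov chain obtained by iterated random barycentric subdivision started from an arbitrary triangle, and let $(X_n,Y_n)$ be the characterizing point of $\mathcal T(n)$. Then almost surely the limit set $\bigcap_{p\in\mathbb N}\overline{\{X_n: n\ge p\}}$ of the sequence $(X_n)_{n\in\mathbb N}$ equals $[0,1/2]$.
   Context: A triangle is given by three points of the plane which are not all equal. Barycentric subdivision: if a triangle has vertices $A,B,C$, let $D,E,F$ be the midpoints of $[A,B],[B,C],[C,A]$ and $G$ its barycenter; the medians cut it into the six triangles $\{A,D,G\},\{D,B,G\},\{B,E,G\},\{E,C,G\},\{C,F,G\},\{F,A,G\}$. The triangle Markov chain: $\mathcal T(0)$ is given and $\mathcal T(n+1)$ is chosen uniformly among the six triangles of the barycentric subdivision of $\mathcal T(n)$, independently of the past. Characterizing point: there is a similitude mapping the triangle onto a triangle with vertices $(0,0)$, $(1,0)$, $(x,y)$, $0\le x\le1/2$, $y\ge0$, sending its longest edge onto $[(0,0),(1,0)]$ and its shortest edge onto $[(0,0),(x,y)]$; $(x,y)$ is unique and is the characterizing point. *)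

theory Defs
  imports "HOL-Probability.Probability"
begin

type_synonym triangle = "complex \<times> complex \<times> complex"

definition is_triangle :: "triangle \<Rightarrow> bool" where
  "is_triangle T \<longleftrightarrow> (case T of (A, B, C) \<Rightarrow> \<not> (A = B \<and> B = C))"

definition similitude :: "(complex \<Rightarrow> complex) \<Rightarrow> bool" where
  "similitude f \<longleftrightarrow> (\<exists>a b. a \<noteq> 0 \<and>
      ((\<forall>z. f z = a * z + b) \<or> (\<forall>z. f z = a * cnj z + b)))"

definition subdiv :: "triangle \<Rightarrow> nat \<Rightarrow> triangle" where
  "subdiv T k = (case T of (A, B, C) \<Rightarrow>
     (let D = (A + B) / 2; E = (B + C) / 2; F = (C + A) / 2; G = (A + B + C) / 3 in
      if k = 0 then (A, D, G) else if k = 1 then (D, B, G) else if k = 2 then (B, E, G)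
      else if k = 3 then (E, C, G) else if k = 4 then (C, F, G) else (F, A, G)))"

text \<open>p is a characterizing point of T: 0 \<le> Re p \<le> 1/2, Im p \<ge> 0, and some similitude
  maps the vertices of T onto the vertices 0, 1, p (in some order) such that the image
  of a longest edge of T is [0,1] and the image of a shortest edge is [0,p].
  Since similitudes scale all lengths by the same factor, the latter means that in the
  image triangle [0,1] is a longest and [0,p] a shortest edge.\<close>

definition char_point_rel :: "triangle \<Rightarrow> complex \<Rightarrow> bool" where
  "char_point_rel T p \<longleftrightarrow> (case T of (A, B, C) \<Rightarrow>
     0 \<le> Re p \<and> Re p \<le> 1/2 \<and> 0 \<le> Im p \<and>
     (\<exists>f. similitude f \<and>
        (f A, f B, f C) \<in> {(0, 1, p), (0, p, 1), (1, 0, p), (1, p, 0), (p, 0, 1), (p, 1, 0)}) \<and>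
     cmod (p - 1) \<le> cmod (1 - 0) \<and> cmod (p - 0) \<le> cmod (1 - 0) \<and>
     cmod (p - 0) \<le> cmod (p - 1))"

definition char_point :: "triangle \<Rightarrow> complex" where
  "char_point T = (THE p. char_point_rel T p)"

definition choice_space :: "nat stream measure" where
  "choice_space = stream_space (measure_pmf (pmf_of_set {0..<6::nat}))"

primrec tri_chain :: "triangle \<Rightarrow> nat stream \<Rightarrow> nat \<Rightarrow> triangle" where
  "tri_chain T0 \<omega> 0 = T0"
| "tri_chain T0 \<omega> (Suc n) = subdiv (tri_chain T0 \<omega> n) (\<omega> !! n)"

end

theory Submission
  imports Defs
begin

text \<open>
  Fix a vertex \<open>P\<close> of a triangle and let \<open>u\<close>, \<open>v\<close> be the edge vectors from \<open>P\<close>. The two triangles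
  of the subdivision that contain \<open>P\<close> have edge vectors \<open>u/2, (u+v)/3\<close> and \<open>v/2, (u+v)/3\<close>, so they
  act on the complex ratio \<open>\<rho> = u/v\<close> by \<open>\<rho> \<mapsto> 3\<rho>/(2(1+\<rho>))\<close> and \<open>\<rho> \<mapsto> 3/(2(1+\<rho>))\<close>. Both maps
  contract near the real segment \<open>[1/2,1]\<close>, and they send it onto \<open>[1/2,3/4]\<close> and \<open>[3/4,1]\<close>: the
  segment is the attractor of the two maps, and a suitable word of fixed length brings every such
  ratio close to a prescribed real \<open>\<tau>\<close> in it, where the characterizing point is close to \<open>1-\<tau>\<close>.
  If \<open>u\<close> is the longest edge, then \<open>v/u\<close> is moved by the affine contraction
  \<open>s \<mapsto> 2(1+s)/3\<close> with fixed point \<open>2\<close>, so five steps bring any triangle to the good region.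
  Hence every open interval meeting \<open>[0,1/2]\<close> is reached by \<open>X\<close> within a number of steps and with
  a probability that do not depend on the current triangle, so it is visited infinitely often
  almost surely.
\<close>

section \<open>Characterizing points\<close>

text \<open>Shape does not depend on the order of the vertices, while triples do; this relation
  allows a distinguished vertex to be put first.\<close>

definition vertex_perm :: "triangle \<Rightarrow> triangle \<Rightarrow> bool" where
  "vertex_perm T T' \<longleftrightarrow> (case T of (A, B, C) \<Rightarrow>
     T' \<in> {(A, B, C), (A, C, B), (B, A, C), (B, C, A), (C, A, B), (C, B, A)})"

text \<open>If \<^term>\<open>s \<le> m \<and> m \<le> l\<close> are the squared side lengths, the characterizing point satisfies
  \<^term>\<open>(cmod p)\<^sup>2 = s / l\<close> and \<^term>\<open>(cmod (p - 1))\<^sup>2 = m / l\<close>, so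
  \<^term>\<open>Re p = (l + s - m) / (2 * l)\<close>. The definition below expresses this symmetrically in the
  three squared lengths, through their minimum, maximum and sum.\<close>

definition normalized_Re :: "real \<Rightarrow> real \<Rightarrow> real \<Rightarrow> real" where
  "normalized_Re a b c =
     1 + min a (min b c) / max a (max b c) - (a + b + c) / (2 * max a (max b c))"

definition normalized_norm_sq :: "real \<Rightarrow> real \<Rightarrow> real \<Rightarrow> real" where
  "normalized_norm_sq a b c = min a (min b c) / max a (max b c)"

lemma normalized_scale:
  assumes "r > 0"
  shows "normalized_Re (r * a) (r * b) (r * c) = normalized_Re a b c"
    and "normalized_norm_sq (r * a) (r * b) (r * c) = normalized_norm_sq a b c"
proof -
  have 1: "max (r * x) (r * y) = r * max x y" "min (r * x) (r * y) = r * min x y" for x y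
    using assms by (auto simp: max_def min_def)
  have 2: "r * a + r * b + r * c = r * (a + b + c)" "2 * (r * x) = r * (2 * x)" for x
    by (simp_all add: algebra_simps)
  show "normalized_Re (r * a) (r * b) (r * c) = normalized_Re a b c"
    "normalized_norm_sq (r * a) (r * b) (r * c) = normalized_norm_sq a b c"
    unfolding normalized_Re_def normalized_norm_sq_def 1 2 using assms by simp_all
qed

text \<open>Two adjacent transpositions generate all permutations of the arguments.\<close>

lemma normalized_commute:
  "normalized_Re b a c = normalized_Re a b c" "normalized_Re a c b = normalized_Re a b c"
  "normalized_norm_sq b a c = normalized_norm_sq a b c"
  "normalized_norm_sq a c b = normalized_norm_sq a b c"
proof -
  have "max b (max a c) = max a (max b c)" "min b (min a c) = min a (min b c)"
    "max c b = max b c" "min c b = min b c" "b + a + c = a + b + c" "a + c + b = a + b + c"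
    by linarith+
  then show "normalized_Re b a c = normalized_Re a b c" "normalized_Re a c b = normalized_Re a b c"
    "normalized_norm_sq b a c = normalized_norm_sq a b c"
    "normalized_norm_sq a c b = normalized_norm_sq a b c"
    by (simp_all only: normalized_Re_def normalized_norm_sq_def)
qed

lemma similitude_dist_sq:
  assumes "similitude f"
  obtains r where "r > 0" "\<And>z w. (cmod (f z - f w))\<^sup>2 = r * (cmod (z - w))\<^sup>2"
proof -
  obtain a b where ab: "a \<noteq> 0" "(\<forall>z. f z = a * z + b) \<or> (\<forall>z. f z = a * cnj z + b)"
    using assms by (auto simp: similitude_def)
  have "(cmod (f z - f w))\<^sup>2 = (cmod a)\<^sup>2 * (cmod (z - w))\<^sup>2" for z w
  proof -
    have "f z - f w = a * (z - w) \<or> f z - f w = a * cnj (z - w)"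
      using ab(2) by (auto simp: algebra_simps)
    then have "cmod (f z - f w) = cmod a * cmod (z - w)"
      by (metis complex_mod_cnj norm_mult)
    then show ?thesis by (simp add: power_mult_distrib)
  qed
  then show ?thesis using ab(1) by (intro that[of "(cmod a)\<^sup>2"]) auto
qed

text \<open>The law of cosines, which recovers \<open>Re p\<close> from the squared distances of
  \<open>p\<close> to 0 and 1.\<close>

lemma cmod_diff_one_sq: "(cmod (p - 1))\<^sup>2 = (cmod p)\<^sup>2 - 2 * Re p + 1"
proof -
  have "(cmod (p - 1))\<^sup>2 = (Re p - 1)\<^sup>2 + (Im p)\<^sup>2" by (simp add: cmod_power2)
  also have "\<dots> = (Re p)\<^sup>2 + (Im p)\<^sup>2 - 2 * Re p + 1" by (simp add: power2_diff)
  finally show ?thesis by (simp add: cmod_power2)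
qed

lemma normalized_of_ordered:
  assumes "cmod (p - 1) \<le> 1" "cmod p \<le> 1" "cmod p \<le> cmod (p - 1)"
  shows "normalized_Re 1 ((cmod p)\<^sup>2) ((cmod (p - 1))\<^sup>2) = Re p"
    and "normalized_norm_sq 1 ((cmod p)\<^sup>2) ((cmod (p - 1))\<^sup>2) = (cmod p)\<^sup>2"
proof -
  have "(cmod (p - 1))\<^sup>2 \<le> 1" "(cmod p)\<^sup>2 \<le> 1" "(cmod p)\<^sup>2 \<le> (cmod (p - 1))\<^sup>2"
    using assms power_mono[of _ _ 2] by (auto simp: power_le_one)
  then have *: "max 1 (max ((cmod p)\<^sup>2) ((cmod (p - 1))\<^sup>2)) = 1"
    "min 1 (min ((cmod p)\<^sup>2) ((cmod (p - 1))\<^sup>2)) = (cmod p)\<^sup>2" by linarith+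
  have "(cmod (p - 1))\<^sup>2 = (cmod p)\<^sup>2 - 2 * Re p + 1"
    by (rule cmod_diff_one_sq)
  then show "normalized_Re 1 ((cmod p)\<^sup>2) ((cmod (p - 1))\<^sup>2) = Re p"
    "normalized_norm_sq 1 ((cmod p)\<^sup>2) ((cmod (p - 1))\<^sup>2) = (cmod p)\<^sup>2"
    unfolding normalized_Re_def normalized_norm_sq_def * by (simp_all add: field_simps)
qed

text \<open>A similitude scales all squared lengths by one factor, and the vertices arrive at 0, 1,
  \<open>p\<close> in some order. Both functions ignore scale and order, so they can be evaluated on
  the triangle 0, 1, \<open>p\<close>, whose sides are ordered.\<close>

lemma char_point_rel_normalized:
  assumes "char_point_rel (A, B, C) p"
  shows "Re p = normalized_Re ((cmod (A - B))\<^sup>2) ((cmod (B - C))\<^sup>2) ((cmod (C - A))\<^sup>2)"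
    and "(cmod p)\<^sup>2 = normalized_norm_sq ((cmod (A - B))\<^sup>2) ((cmod (B - C))\<^sup>2) ((cmod (C - A))\<^sup>2)"
proof -
  obtain f where f: "similitude f"
    "(f A, f B, f C) \<in> {(0, 1, p), (0, p, 1), (1, 0, p), (1, p, 0), (p, 0, 1), (p, 1, 0)}"
    using assms by (auto simp: char_point_rel_def)
  obtain r where r: "r > 0" "\<And>z w. (cmod (f z - f w))\<^sup>2 = r * (cmod (z - w))\<^sup>2"
    using similitude_dist_sq[OF f(1)] by blast
  have o: "cmod (p - 1) \<le> 1" "cmod p \<le> 1" "cmod p \<le> cmod (p - 1)"
    using assms by (auto simp: char_point_rel_def)
  have "N ((cmod (f A - f B))\<^sup>2) ((cmod (f B - f C))\<^sup>2) ((cmod (f C - f A))\<^sup>2)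
      = N 1 ((cmod p)\<^sup>2) ((cmod (p - 1))\<^sup>2)"
    if "\<And>a b c. N b a c = N a b c" "\<And>a b c. N a c b = N a b c"
    for N :: "real \<Rightarrow> real \<Rightarrow> real \<Rightarrow> real"
  proof -
    have "cmod (1 - p) = cmod (p - 1)" by (rule norm_minus_commute)
    then show ?thesis using f(2) that by (elim insertE) simp_all
  qed
  note * = this[of normalized_Re, OF normalized_commute(1,2)]
    this[of normalized_norm_sq, OF normalized_commute(3,4)]
  show "Re p = normalized_Re ((cmod (A - B))\<^sup>2) ((cmod (B - C))\<^sup>2) ((cmod (C - A))\<^sup>2)"
    "(cmod p)\<^sup>2 = normalized_norm_sq ((cmod (A - B))\<^sup>2) ((cmod (B - C))\<^sup>2) ((cmod (C - A))\<^sup>2)"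
    using * unfolding r(2) normalized_scale[OF r(1)] normalized_of_ordered[OF o] by simp_all
qed

text \<open>\<open>Re p\<close> and \<open>cmod p\<close> determine \<open>p\<close> up to
  conjugation, and \<open>Im p\<close> is nonnegative.\<close>

lemma char_point_rel_unique:
  assumes "char_point_rel T p" "char_point_rel T q"
  shows "p = q"
proof -
  obtain A B C where T: "T = (A, B, C)" by (cases T)
  note * = char_point_rel_normalized[OF assms(1)[unfolded T]]
    char_point_rel_normalized[OF assms(2)[unfolded T]]
  have "Re p = Re q" "(cmod p)\<^sup>2 = (cmod q)\<^sup>2" using * by simp_all
  then have "(Im p)\<^sup>2 = (Im q)\<^sup>2" by (simp add: cmod_power2)
  moreover have "Im p \<ge> 0" "Im q \<ge> 0" using assms by (auto simp: T char_point_rel_def)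
  ultimately show ?thesis using \<open>Re p = Re q\<close> by (auto intro: complex_eqI)
qed

section \<open>Existence of the characterizing point\<close>

lemma char_point_rel_vertex_perm:
  assumes "vertex_perm T T'" "char_point_rel T' p"
  shows "char_point_rel T p"
proof -
  obtain A B C where T: "T = (A, B, C)" by (cases T)
  obtain A' B' C' where T': "T' = (A', B', C')" by (cases T')
  have v: "(A', B', C') \<in> {(A, B, C), (A, C, B), (B, A, C), (B, C, A), (C, A, B), (C, B, A)}"
    using assms(1) by (simp add: vertex_perm_def T T')
  obtain f where f: "similitude f"
    "(f A', f B', f C') \<in> {(0, 1, p), (0, p, 1), (1, 0, p), (1, p, 0), (p, 0, 1), (p, 1, 0)}"
    using assms by (auto simp: char_point_rel_def T')
  have "(f A, f B, f C) \<in> {(0, 1, p), (0, p, 1), (1, 0, p), (1, p, 0), (p, 0, 1), (p, 1, 0)}"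
    using v f(2) by auto
  then show ?thesis using assms(2) f(1) unfolding T T' char_point_rel_def prod.case by blast
qed

lemma vertex_perm_ordered:
  obtains A B C where "vertex_perm T (A, B, C)"
    "cmod (C - B) \<le> cmod (B - A)" "cmod (C - A) \<le> cmod (C - B)"
proof -
  obtain A B C where T: "T = (A, B, C)" by (cases T)
  define l where "l X Y = cmod (X - Y)" for X Y
  have c: "l X Y = l Y X" for X Y unfolding l_def by (rule norm_minus_commute)
  have "\<exists>A' B' C'. vertex_perm T (A', B', C') \<and> l C' B' \<le> l B' A' \<and> l C' A' \<le> l C' B'"
    unfolding T vertex_perm_def using c[of A B] c[of B C] c[of C A]
    by simp (smt (verit, ccfv_threshold))
  then show ?thesis using that unfolding l_def by blast
qed

lemma char_point_rel_exists:
  assumes "is_triangle T"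
  shows "\<exists>p. char_point_rel T p"
proof -
  obtain A B C where v: "vertex_perm T (A, B, C)"
    and o: "cmod (C - B) \<le> cmod (B - A)" "cmod (C - A) \<le> cmod (C - B)"
    by (rule vertex_perm_ordered)
  have "A \<noteq> B"
  proof
    assume "A = B"
    then have "B = C" using o by simp
    then show False using \<open>A = B\<close> v assms by (cases T) (auto simp: vertex_perm_def is_triangle_def)
  qed
  \<comment> \<open>The affine map with factor \<open>a\<close> sends the longest edge from
    \<open>A\<close> to \<open>B\<close> onto the segment from 0 to 1; if \<open>C\<close> lands
    below the real axis, a reflection follows.\<close>
  define a where "a = 1 / (B - A)"
  define q where "q = a * (C - A)"
  have a: "a \<noteq> 0" "a * (B - A) = 1" using \<open>A \<noteq> B\<close> by (auto simp: a_def)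
  have q1: "q - 1 = a * (C - B)" using a(2) by (simp add: q_def algebra_simps)
  have ca: "cmod a * cmod (B - A) = 1" using a(2) by (metis norm_mult norm_one)
  have n1: "cmod (q - 1) \<le> 1"
    unfolding q1 norm_mult using o(1) ca by (metis mult_left_mono norm_ge_zero)
  have n2: "cmod q \<le> cmod (q - 1)"
    unfolding q1 norm_mult unfolding q_def norm_mult using o(2) by (simp add: mult_left_mono)
  define p where "p = (if Im q \<ge> 0 then q else cnj q)"
  have "similitude (\<lambda>z. a * z + (- a * A))" "similitude (\<lambda>z. cnj a * cnj z + cnj (- a * A))"
    unfolding similitude_def using a(1) by (metis complex_cnj_zero_iff)+
  moreover have "a * A + (- a * A) = 0" "a * B + (- a * A) = 1" "a * C + (- a * A) = q"
    using a(2) by (simp_all add: q_def algebra_simps)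
  moreover from this have "cnj a * cnj A + cnj (- a * A) = 0" "cnj a * cnj B + cnj (- a * A) = 1"
    "cnj a * cnj C + cnj (- a * A) = cnj q"
    by (metis complex_cnj_add complex_cnj_mult complex_cnj_zero complex_cnj_one)+
  ultimately have f: "\<exists>f. similitude f \<and> f A = 0 \<and> f B = 1 \<and> f C = p"
    unfolding p_def by (smt (verit))
  have np: "cmod (p - 1) \<le> 1" "cmod p \<le> cmod (p - 1)"
    using n1 n2 complex_mod_cnj[of "q - 1"] by (auto simp: p_def)
  note e = cmod_diff_one_sq[of p]
  have "(cmod (p - 1))\<^sup>2 \<le> 1" "(cmod p)\<^sup>2 \<le> (cmod (p - 1))\<^sup>2"
    using np by (auto simp: power_le_one intro: power_mono)
  then have "0 \<le> Re p" "Re p \<le> 1/2" using e zero_le_power2[of "cmod p"] by linarith+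
  moreover have "Im p \<ge> 0" by (simp add: p_def)
  moreover have "cmod p \<le> 1" using np by linarith
  ultimately have "char_point_rel (A, B, C) p"
    unfolding char_point_rel_def using f np by auto
  then show ?thesis using char_point_rel_vertex_perm[OF v] by blast
qed

lemma char_point_rel_char_point:
  assumes "is_triangle T"
  shows "char_point_rel T (char_point T)"
proof -
  have "\<exists>!p. char_point_rel T p"
    using char_point_rel_exists[OF assms] char_point_rel_unique by blast
  then show ?thesis unfolding char_point_def by (rule theI')
qed

lemma Re_char_point_range:
  assumes "is_triangle T"
  shows "Re (char_point T) \<in> {0..1/2}"
proof -
  obtain A B C where T: "T = (A, B, C)" by (cases T)
  show ?thesis using char_point_rel_char_point[OF assms] unfolding T char_point_rel_def by simp
qed

lemma Re_char_point:
  assumes "is_triangle T" "vertex_perm T (P, X, Y)"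
  shows "Re (char_point T) =
    normalized_Re ((cmod (X - P))\<^sup>2) ((cmod (Y - P))\<^sup>2) ((cmod (Y - X))\<^sup>2)"
proof -
  obtain A B C where T: "T = (A, B, C)" by (cases T)
  define l where "l X Y = (cmod (X - Y))\<^sup>2" for X Y
  have c: "l X Y = l Y X" for X Y unfolding l_def by (simp add: norm_minus_commute)
  have "Re (char_point T) = normalized_Re (l A B) (l B C) (l C A)"
    using char_point_rel_normalized(1) char_point_rel_char_point[OF assms(1)]
    unfolding T l_def by blast
  also have "\<dots> = normalized_Re (l X P) (l Y P) (l Y X)"
    using assms(2) c[of A B] c[of B C] c[of C A] 
    unfolding T vertex_perm_def by (auto simp: normalized_commute)
  finally show ?thesis by (simp add: l_def)
qed

lemma is_triangle_subdiv:
  assumes "is_triangle T"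
  shows "is_triangle (subdiv T k)"
proof -
  obtain A B C where T: "T = (A, B, C)" by (cases T)
  define D E F G where "D = (A + B) / 2" and "E = (B + C) / 2" and "F = (C + A) / 2"
    and "G = (A + B + C) / 3"
  have ABC: "\<not> (A = B \<and> B = C)" using assms by (simp add: T is_triangle_def)
  have *: "2 * D = A + B" "2 * E = B + C" "2 * F = C + A" "3 * G = A + B + C"
    by (simp_all add: D_def E_def F_def G_def)
  \<comment> \<open>In a collapsed subtriangle the midpoint \<open>M\<close> of an edge equals one
    of its ends, so that edge is a point; \<open>M = G\<close> then forces the third vertex to
    coincide.\<close>
  have **: "X = Y \<and> Y = Z" if "2 * M = X + Y" "3 * G = X + Y + Z" "M = X \<or> M = Y" "M = G"
    for X Y Z M :: complex
  proof -
    have "X = M" "Y = M" using that(1,3) by auto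
    with that(2,4) show ?thesis by simp
  qed
  have G: "3 * G = B + C + A" "3 * G = C + A + B" using *(4) by (simp_all only: add_ac)
  have "\<not> (A = D \<and> D = G)" "\<not> (D = B \<and> B = G)"
    using ABC **[OF *(1) *(4)] by metis+
  moreover have "\<not> (B = E \<and> E = G)" "\<not> (E = C \<and> C = G)"
    using ABC **[OF *(2) G(1)] by metis+
  moreover have "\<not> (C = F \<and> F = G)" "\<not> (F = A \<and> A = G)"
    using ABC **[OF *(3) G(2)] by metis+
  ultimately show ?thesis
    unfolding T is_triangle_def subdiv_def Let_def
    by (simp add: D_def[symmetric] E_def[symmetric] F_def[symmetric] G_def[symmetric])
qed

section \<open>Steering the shape of a triangle\<close>

text \<open>Records one successful word of exactly \<open>n\<close> choices; such a word has
  probability \<open>(1/6) ^ n\<close>.\<close>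

primrec reach_in :: "triangle set \<Rightarrow> nat \<Rightarrow> triangle \<Rightarrow> bool" where
  "reach_in G 0 T \<longleftrightarrow> T \<in> G"
| "reach_in G (Suc n) T \<longleftrightarrow> (\<exists>k<6. reach_in G n (subdiv T k))"

text \<open>Concatenation of words. With \<open>n = 0\<close> it becomes monotonicity in the target
  set.\<close>

lemma reach_in_trans:
  assumes "reach_in G m T" "\<And>T'. T' \<in> G \<Longrightarrow> reach_in H n T'"
  shows "reach_in H (m + n) T"
  using assms(1)
proof (induction m arbitrary: T)
  case (Suc m)
  then show ?case by (simp del: split_paired_All split_paired_Ex) blast
qed (simp add: assms(2))

text \<open>The six subtriangles correspond to the choices of a vertex \<open>P\<close> and an edge
  from \<open>P\<close> to \<open>X\<close>.\<close>

lemma subdiv_at_apex: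
  assumes "vertex_perm T (P, X, Y)"
  shows "\<exists>k<6. vertex_perm (subdiv T k) (P, (P + X) / 2, (P + X + Y) / 3)"
proof -
  obtain A B C where T: "T = (A, B, C)" by (cases T)
  have sub: "vertex_perm (subdiv T 0) (A, (A + B) / 2, (A + B + C) / 3)"
    "vertex_perm (subdiv T 1) (B, (B + A) / 2, (B + A + C) / 3)"
    "vertex_perm (subdiv T 2) (B, (B + C) / 2, (B + C + A) / 3)"
    "vertex_perm (subdiv T 3) (C, (C + B) / 2, (C + B + A) / 3)"
    "vertex_perm (subdiv T 4) (C, (C + A) / 2, (C + A + B) / 3)"
    "vertex_perm (subdiv T 5) (A, (A + C) / 2, (A + C + B) / 3)"
    by (simp_all add: T subdiv_def Let_def vertex_perm_def add_ac)
  have "(P, X, Y) = (A, B, C) \<or> (P, X, Y) = (B, A, C) \<or> (P, X, Y) = (B, C, A) \<or>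
      (P, X, Y) = (C, B, A) \<or> (P, X, Y) = (C, A, B) \<or> (P, X, Y) = (A, C, B)"
    using assms unfolding T vertex_perm_def prod.case by blast
  then have "\<exists>k\<in>{0, 1, 2, 3, 4, 5}. vertex_perm (subdiv T k) (P, (P + X) / 2, (P + X + Y) / 3)"
    using sub by (elim disjE) (simp_all only: prod.inject, blast+)
  then obtain k where "k \<in> {0, 1, 2, 3, 4, 5}"
    "vertex_perm (subdiv T k) (P, (P + X) / 2, (P + X + Y) / 3)" by blast
  moreover from this(1) have "k < 6" by auto
  ultimately show ?thesis by blast
qed

lemma vertex_perm_swap: "vertex_perm T (P, X, Y) \<Longrightarrow> vertex_perm T (P, Y, X)"
  by (cases T) (auto simp: vertex_perm_def)

text \<open>The shape is recorded by the ratio \<open>\<rho>\<close> of the edges from \<open>P\<close>. The disc of radius \<open>1/2\<close> around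
  \<open>3/4\<close> is mapped into itself by both maps \<open>\<rho> \<mapsto> 3 / (2 * (1 + \<rho>))\<close> and
  \<open>\<rho> \<mapsto> 3/2 - 3 / (2 * (1 + \<rho>))\<close>.\<close>

definition near_shape :: "complex \<Rightarrow> real \<Rightarrow> triangle set" where
  "near_shape \<tau> \<delta> = {T. \<exists>P v \<rho>. vertex_perm T (P, P + \<rho> * v, P + v) \<and> v \<noteq> 0 \<and>
     cmod (\<rho> - 3/4) \<le> 1/2 \<and> cmod (\<rho> - \<tau>) \<le> \<delta>}"

section \<open>Contraction of the two maps on edge ratios\<close>

lemma ball_Re:
  assumes "cmod (\<rho> - 3/4) \<le> 1/2"
  shows "Re (1 + \<rho>) \<ge> 5/4" "cmod (1 + \<rho>) \<ge> 5/4"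
proof -
  have "\<bar>Re (\<rho> - 3/4)\<bar> \<le> 1/2" using assms abs_Re_le_cmod order_trans by blast
  then have "\<bar>Re \<rho> - 3/4\<bar> \<le> 1/2" by simp
  then show "Re (1 + \<rho>) \<ge> 5/4" unfolding abs_le_iff by simp
  then show "cmod (1 + \<rho>) \<ge> 5/4" using complex_Re_le_cmod order_trans by blast
qed

text \<open>The difference is
  \<open>3/2 * (\<sigma> - \<rho>) / ((1 + \<rho>) * (1 + \<sigma>))\<close>; the factors below have
  modulus at least 5/4 and 3/2, whence 4/5.\<close>

lemma mobius_diff:
  fixes \<rho> \<sigma> :: complex
  assumes "cmod (\<rho> - 3/4) \<le> 1/2" "Re \<sigma> \<ge> 1/2"
  shows "cmod (3 / (2 * (1 + \<rho>)) - 3 / (2 * (1 + \<sigma>))) \<le> 4/5 * cmod (\<rho> - \<sigma>)"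
proof -
  note \<rho> = ball_Re(2)[OF assms(1)]
  have "Re (1 + \<sigma>) \<ge> 3/2" using assms by simp
  then have \<sigma>: "cmod (1 + \<sigma>) \<ge> 3/2" using complex_Re_le_cmod order_trans by blast
  have nz: "1 + \<rho> \<noteq> 0" "1 + \<sigma> \<noteq> 0" using \<rho> \<sigma> by auto
  have "3 / (2 * z) - 3 / (2 * w) = 3/2 * (w - z) / (z * w)" if "z \<noteq> 0" "w \<noteq> 0" for z w :: complex
    using that by (simp add: field_simps)
  from this[OF nz]
  have "3 / (2 * (1 + \<rho>)) - 3 / (2 * (1 + \<sigma>)) = 3/2 * (\<sigma> - \<rho>) / ((1 + \<rho>) * (1 + \<sigma>))"
    by simp
  then have "cmod (3 / (2 * (1 + \<rho>)) - 3 / (2 * (1 + \<sigma>)))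
      = 3/2 * cmod (\<rho> - \<sigma>) / (cmod (1 + \<rho>) * cmod (1 + \<sigma>))"
    by (simp only: norm_mult norm_divide norm_minus_commute[of \<sigma>] norm_numeral)
  also have "\<dots> \<le> 3/2 * cmod (\<rho> - \<sigma>) / (5/4 * (3/2))"
    using \<rho> \<sigma> by (intro divide_left_mono mult_mono mult_pos_pos) auto
  finally show ?thesis by simp
qed

text \<open>The difference equals \<open>3/4 * (1 - \<rho>) / (1 + \<rho>)\<close>, of modulus at
  most 9/20.\<close>

lemma mobius_ball:
  fixes \<rho> :: complex
  assumes "cmod (\<rho> - 3/4) \<le> 1/2"
  shows "cmod (3 / (2 * (1 + \<rho>)) - 3/4) \<le> 1/2"
proof -
  note \<rho> = ball_Re(2)[OF assms(1)]
  have nz: "1 + \<rho> \<noteq> 0" using \<rho> by auto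
  have "3 / (2 * z) - 3/4 = (3/4 * (2 - z)) / z" if "z \<noteq> 0" for z :: complex
    using that by (simp add: field_simps)
  from this[OF nz]
  have "3 / (2 * (1 + \<rho>)) - 3/4 = (3/4 * (1/4 - (\<rho> - 3/4))) / (1 + \<rho>)" by simp
  moreover have "cmod (1/4 - (\<rho> - 3/4)) \<le> 1/4 + 1/2"
    using norm_triangle_ineq4[of "1/4" "\<rho> - 3/4"] assms by simp
  ultimately have "cmod (3 / (2 * (1 + \<rho>)) - 3/4) \<le> 3/4 * (3/4) / (5/4)"
    using \<rho> unfolding norm_divide norm_mult
    by (simp only: norm_divide norm_mult) (intro frac_le mult_mono; simp)
  then show ?thesis by simp
qed

text \<open>The new reference edge \<open>w\<close> runs from \<open>P\<close> to the barycenter.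
  The two half edges have ratios \<open>q\<close> and \<open>3/2 - q\<close> to it, which are mirror
  images in 3/4, so the estimates for \<open>q\<close> serve both.\<close>

lemma near_shape_step:
  assumes "T \<in> near_shape \<sigma> \<delta>" "Re \<sigma> \<ge> 1/2"
  shows "\<exists>k<6. subdiv T k \<in> near_shape (3 / (2 * (1 + \<sigma>))) (4/5 * \<delta>)"
    and "\<exists>k<6. subdiv T k \<in> near_shape (3/2 - 3 / (2 * (1 + \<sigma>))) (4/5 * \<delta>)"
proof -
  obtain P v \<rho> where T: "vertex_perm T (P, P + \<rho> * v, P + v)" "v \<noteq> 0"
    and \<rho>: "cmod (\<rho> - 3/4) \<le> 1/2" "cmod (\<rho> - \<sigma>) \<le> \<delta>"
    using assms(1) by (auto simp: near_shape_def)
  define q where "q = 3 / (2 * (1 + \<rho>))"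
  define w where "w = (1 + \<rho>) / 3 * v"
  have nz: "1 + \<rho> \<noteq> 0" using ball_Re(2)[OF \<rho>(1)] by auto
  then have w: "w \<noteq> 0" using T(2) by (simp add: w_def)
  have "(P + (P + \<rho> * v)) / 2 = P + (\<rho> * v) / 2"
    "(P + (P + v)) / 2 = P + v / 2" by (simp_all add: field_simps)
  moreover have "v / 2 = q * w"
  proof -
    have "v / 2 = 3 / (2 * z) * (z / 3 * v)" if "z \<noteq> 0" for z using that by simp
    from this[OF nz] show ?thesis unfolding q_def w_def .
  qed
  moreover from this have "(\<rho> * v) / 2 = (3/2 - q) * w"
    unfolding w_def by (simp add: field_simps)
  moreover have "(P + (P + \<rho> * v) + (P + v)) / 3 = P + w" "(P + (P + v) + (P + \<rho> * v)) / 3 = P + w"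
    unfolding w_def by (simp_all add: field_simps)
  ultimately have
    1: "\<exists>k<6. vertex_perm (subdiv T k) (P, P + (3/2 - q) * w, P + w)" and
    2: "\<exists>k<6. vertex_perm (subdiv T k) (P, P + q * w, P + w)"
    using subdiv_at_apex[OF T(1)] subdiv_at_apex[OF vertex_perm_swap[OF T(1)]]
    by (simp_all only:)
  have q: "cmod (q - 3/4) \<le> 1/2" "cmod (q - 3 / (2 * (1 + \<sigma>))) \<le> 4/5 * \<delta>"
    unfolding q_def using mobius_ball[OF \<rho>(1)] mobius_diff[OF \<rho>(1) assms(2)] \<rho>(2) by auto
  show "\<exists>k<6. subdiv T k \<in> near_shape (3 / (2 * (1 + \<sigma>))) (4/5 * \<delta>)"
    using 2 w q unfolding near_shape_def by blast
  have "(3/2 - q) - 3/4 = - (q - 3/4)"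
    "(3/2 - q) - (3/2 - 3 / (2 * (1 + \<sigma>))) = - (q - 3 / (2 * (1 + \<sigma>)))"
    by simp_all
  then have "cmod ((3/2 - q) - 3/4) \<le> 1/2"
    "cmod ((3/2 - q) - (3/2 - 3 / (2 * (1 + \<sigma>)))) \<le> 4/5 * \<delta>"
    using q by (metis norm_minus_cancel)+
  then show "\<exists>k<6. subdiv T k \<in> near_shape (3/2 - 3 / (2 * (1 + \<sigma>))) (4/5 * \<delta>)"
    using 1 w unfolding near_shape_def by blast
qed

text \<open>The word is found from its end: the target \<tau> is pulled back through whichever map
  covers it, and the preimage lies in the segment again. The start must therefore be within 1 of
  every point of the segment.\<close>

lemma near_shape_reach:
  fixes \<tau> :: real
  assumes "\<tau> \<in> {1/2..1}" "\<And>\<sigma>. \<sigma> \<in> {1/2..1} \<Longrightarrow> T \<in> near_shape (of_real \<sigma>) 1"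
  shows "reach_in (near_shape (of_real \<tau>) ((4/5) ^ n)) n T"
  using assms(1)
proof (induction n arbitrary: \<tau>)
  case 0
  then show ?case using assms(2) by simp
next
  case (Suc n)
  have "\<exists>\<sigma>\<in>{1/2..1}. \<tau> = 3 / (2 * (1 + \<sigma>)) \<or> \<tau> = 3/2 - 3 / (2 * (1 + \<sigma>))"
  proof (cases "\<tau> \<le> 3/4")
    case True
    define s where "s = 3 / (2 * (3/2 - \<tau>)) - 1"
    have "s \<in> {1/2..1}" "\<tau> = 3/2 - 3 / (2 * (1 + s))"
      using True Suc.prems unfolding s_def by (auto simp: field_simps)
    then show ?thesis by blast
  next
    case False
    define s where "s = 3 / (2 * \<tau>) - 1"
    have "s \<in> {1/2..1}" "\<tau> = 3 / (2 * (1 + s))"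
      using False Suc.prems unfolding s_def by (auto simp: field_simps)
    then show ?thesis by blast
  qed
  then obtain \<sigma> where \<sigma>: "\<sigma> \<in> {1/2..1}"
    "\<tau> = 3 / (2 * (1 + \<sigma>)) \<or> \<tau> = 3/2 - 3 / (2 * (1 + \<sigma>))" by blast
  have "reach_in (near_shape (of_real \<tau>) ((4/5) ^ Suc n)) 1 T'"
    if "T' \<in> near_shape (of_real \<sigma>) ((4/5) ^ n)" for T'
    using near_shape_step[OF that] \<sigma> by auto
  from reach_in_trans[OF Suc.IH[OF \<sigma>(1)] this] show ?case by simp
qed

lemma reach_ball:
  assumes "is_triangle T"
  shows "reach_in {T'. \<forall>\<sigma>\<in>{1/2..1}. T' \<in> near_shape (of_real \<sigma>) 1} 5 T"
proof -
  obtain X P Y where v: "vertex_perm T (P, X, Y)"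
    and o: "cmod (Y - X) \<le> cmod (X - P)" "cmod (Y - P) \<le> cmod (Y - X)"
    by (rule vertex_perm_ordered)
  have XP: "X \<noteq> P"
  proof
    assume "X = P"
    then have "Y = X" using o by simp
    then show False using \<open>X = P\<close> v assms by (cases T) (auto simp: vertex_perm_def is_triangle_def)
  qed
  define u s where "u = X - P" and "s = (Y - P) / (X - P)"
  have s: "cmod (s - 2) \<le> 3"
  proof -
    have "cmod s \<le> 1" using o XP by (simp add: s_def norm_divide divide_le_eq_1)
    then show ?thesis using norm_triangle_ineq4[of s 2] by simp
  qed
  have u: "u \<noteq> 0" and T: "vertex_perm T (P, P + u, P + s * u)"
    using v XP by (simp_all add: u_def s_def)
  \<comment> \<open>Halving the edge \<open>u\<close> at every step keeps \<open>P\<close> and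
    multiplies \<open>s - 2\<close> by 2/3. Since \<open>3 * (2/3) ^ 5 = 32/81\<close>, five steps
    bring \<open>s\<close> within 1/2 of 2.\<close>
  define H where "H n = {T. \<exists>u s. u \<noteq> 0 \<and> vertex_perm T (P, P + u, P + s * u) \<and>
    cmod (s - 2) \<le> 3 * (2/3) ^ n}" for n
  have step: "reach_in (H (Suc n)) 1 T'" if "T' \<in> H n" for T' n
  proof -
    obtain u s where *: "u \<noteq> 0" "vertex_perm T' (P, P + u, P + s * u)"
      "cmod (s - 2) \<le> 3 * (2/3) ^ n" using \<open>T' \<in> H n\<close> by (auto simp: H_def)
    have "(P + (P + u)) / 2 = P + u / 2"
      "(P + (P + u) + (P + s * u)) / 3 = P + (2/3 * (1 + s)) * (u / 2)"
      by (simp_all add: field_simps)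
    with subdiv_at_apex[OF *(2)] obtain k where
      k: "k < 6" "vertex_perm (subdiv T' k) (P, P + u / 2, P + (2/3 * (1 + s)) * (u / 2))" by metis
    have "2/3 * (1 + s) - 2 = 2/3 * (s - 2)" by (simp add: field_simps)
    then have "cmod (2/3 * (1 + s) - 2) = 2/3 * cmod (s - 2)"
      by (simp only: norm_mult norm_divide norm_numeral)
    also have "\<dots> \<le> 3 * (2/3) ^ Suc n" using *(3) by simp
    finally have "cmod (2/3 * (1 + s) - 2) \<le> 3 * (2/3) ^ Suc n" .
    moreover have "u / 2 \<noteq> 0" using *(1) by simp
    ultimately have "subdiv T' k \<in> H (Suc n)" using k(2) unfolding H_def by blast
    then show ?thesis using k(1) by auto
  qed
  have "reach_in (H n) n T" for n
  proof (induction n)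
    case 0
    then show ?case using u T s by (auto simp: H_def)
  next
    case (Suc n)
    from reach_in_trans[OF Suc step] show ?case by simp
  qed
  moreover have "\<forall>\<sigma>\<in>{1/2..1}. T' \<in> near_shape (of_real \<sigma>) 1" if "T' \<in> H 5" for T'
  proof -
    obtain u s where *: "u \<noteq> 0" "vertex_perm T' (P, P + u, P + s * u)"
      "cmod (s - 2) \<le> 3 * (2/3) ^ 5" using \<open>T' \<in> H 5\<close> by (auto simp: H_def)
    then have s: "cmod (s - 2) \<le> 1/2" by (simp add: eval_nat_numeral)
    then have s2: "cmod s \<ge> 3/2" using norm_triangle_ineq2[of 2 "2 - s"] by (simp add: norm_minus_commute)
    then have "s \<noteq> 0" by auto
    \<comment> \<open>With \<open>s * u\<close> as reference edge the ratio is \<open>1 / s\<close>,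
      which lies within 1/6 of 1/2 and so within 5/12 of 3/4.\<close>
    then have "1 / s - 3/4 = (2 - s) / (2 * s) - 1/4" by (simp add: field_simps)
    then have "cmod (1 / s - 3/4) \<le> cmod (2 - s) / (2 * cmod s) + 1/4"
      using norm_triangle_ineq4[of "(2 - s) / (2 * s)" "1/4"] by (simp add: norm_divide norm_mult)
    also have "cmod (2 - s) / (2 * cmod s) \<le> (1/2) / (2 * (3/2))"
      using s s2 by (intro frac_le) (auto simp: norm_minus_commute)
    finally have b: "cmod (1 / s - 3/4) \<le> 1/2" by simp
    have "cmod (1 / s - of_real \<sigma>) \<le> 1" if "\<sigma> \<in> {1/2..1}" for \<sigma>
    proof -
      have "cmod (of_real (3/4 - \<sigma>)) \<le> 1/4" using that by (simp only: norm_of_real abs_le_iff) auto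
      then show ?thesis using b norm_triangle_ineq[of "1 / s - 3/4" "of_real (3/4 - \<sigma>)"] by simp
    qed
    moreover have "vertex_perm T' (P, P + (1 / s) * (s * u), P + s * u)"
      using *(2) \<open>s \<noteq> 0\<close> by simp
    moreover have "s * u \<noteq> 0" using * \<open>s \<noteq> 0\<close> by simp
    ultimately show ?thesis unfolding near_shape_def using b by blast
  qed
  ultimately show ?thesis
    using reach_in_trans[of "H 5" 5 T _ 0] by simp
qed

text \<open>After scaling, \<open>Re (char_point T)\<close> is a continuous function
  \<open>g\<close> of the ratio. At the real ratio \<tau> the triangle is flat, with longest side 1
  and shortest side \<open>1 - \<tau>\<close>, and \<open>g\<close> equals
  \<open>1 - \<tau>\<close>.\<close>

lemma Re_char_point_near_shape:
  assumes "\<tau> \<in> {1/2..1}" "\<epsilon> > 0"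
  shows "\<exists>\<delta>>0. \<forall>T \<in> near_shape (of_real \<tau>) \<delta>. is_triangle T \<longrightarrow>
    \<bar>Re (char_point T) - (1 - \<tau>)\<bar> < \<epsilon>"
proof -
  define g where "g \<rho> = normalized_Re ((cmod \<rho>)\<^sup>2) 1 ((cmod (1 - \<rho>))\<^sup>2)" for \<rho>
  have pos: "max x (max 1 y) \<noteq> 0" for x y :: real by (auto simp: max_def)
  have "isCont g (of_real \<tau>)"
    unfolding g_def normalized_Re_def by (intro continuous_intros) (auto simp: pos)
  then obtain d where d: "d > 0" "\<And>\<rho>. cmod (\<rho> - of_real \<tau>) < d \<Longrightarrow> \<bar>g \<rho> - g (of_real \<tau>)\<bar> < \<epsilon>"
    using assms(2) unfolding continuous_at_eps_delta dist_norm real_norm_def by metis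
  have *: "cmod (1 - of_real \<tau>) = 1 - \<tau>" "cmod (of_real \<tau>) = \<tau>"
    using assms(1) norm_of_real[of "1 - \<tau>", where 'a = complex] by simp_all
  have "\<tau>\<^sup>2 \<le> 1" "(1 - \<tau>)\<^sup>2 \<le> \<tau>\<^sup>2" "(1 - \<tau>)\<^sup>2 \<le> 1"
    using assms(1) by (auto simp: power_le_one intro!: power_mono)
  then have **: "max (\<tau>\<^sup>2) (max 1 ((1 - \<tau>)\<^sup>2)) = 1" "min (\<tau>\<^sup>2) (min 1 ((1 - \<tau>)\<^sup>2)) = (1 - \<tau>)\<^sup>2"
    by linarith+
  have g: "g (of_real \<tau>) = 1 - \<tau>"
    unfolding g_def normalized_Re_def * ** by (simp add: power2_eq_square field_simps)
  \<comment> \<open>Half of \<open>d\<close>, because \<open>near_shape\<close> has a closed bound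
    and continuity a strict one.\<close>
  have "\<bar>Re (char_point T) - (1 - \<tau>)\<bar> < \<epsilon>" if T: "T \<in> near_shape (of_real \<tau>) (d / 2)" "is_triangle T" for T
  proof -
    obtain P v \<rho> where *: "vertex_perm T (P, P + \<rho> * v, P + v)" "v \<noteq> 0" "cmod (\<rho> - \<tau>) \<le> d / 2"
      using T by (auto simp: near_shape_def)
    have "v - \<rho> * v = v * (1 - \<rho>)" by (simp add: algebra_simps)
    then have "Re (char_point T) = normalized_Re ((cmod v)\<^sup>2 * (cmod \<rho>)\<^sup>2) ((cmod v)\<^sup>2 * 1)
        ((cmod v)\<^sup>2 * (cmod (1 - \<rho>))\<^sup>2)"
      using Re_char_point[OF T(2) *(1)] by (simp add: norm_mult power_mult_distrib mult.commute)
    also have "\<dots> = g \<rho>" unfolding g_def using *(2) by (intro normalized_scale(1)) auto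
    finally show ?thesis using d *(3) g by simp
  qed
  then show ?thesis using d(1) by (intro exI[of _ "d / 2"]) auto
qed

lemma reach_interval:
  assumes "x \<in> {a<..<b}" "x \<in> {0..1/2}"
  shows "\<exists>N. \<forall>T. is_triangle T \<longrightarrow> reach_in {T. Re (char_point T) \<in> {a<..<b}} N T"
proof -
  define \<epsilon> where "\<epsilon> = min (x - a) (b - x)"
  have t: "1 - x \<in> {1/2..1}" using assms(2) by auto
  obtain \<delta> where \<delta>: "\<delta> > 0" "\<And>T. T \<in> near_shape (of_real (1 - x)) \<delta> \<Longrightarrow> is_triangle T \<Longrightarrow>
    \<bar>Re (char_point T) - x\<bar> < \<epsilon>"
    using Re_char_point_near_shape[OF t, of \<epsilon>] assms(1) by (auto simp: \<epsilon>_def)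
  obtain n where n: "(4/5::real) ^ n < \<delta>" using real_arch_pow_inv[OF \<delta>(1), of "4/5"] by auto
  \<comment> \<open>The estimate for \<open>char_point\<close> holds only for genuine triangles, so
    this property is carried along the word.\<close>
  have tri: "reach_in (G \<inter> Collect is_triangle) m T" if "reach_in G m T" "is_triangle T" for G m T
    using that
  proof (induction m arbitrary: T)
    case (Suc m)
    then show ?case using is_triangle_subdiv
      by (simp del: split_paired_All split_paired_Ex) blast
  qed simp
  have "reach_in {T. Re (char_point T) \<in> {a<..<b}} (5 + n) T" if "is_triangle T" for T
  proof -
    have "reach_in (near_shape (of_real (1 - x)) ((4/5) ^ n)) (5 + n) T"
      by (rule reach_in_trans[OF reach_ball[OF that]]) (use near_shape_reach[OF t] in auto)
    moreover have "Re (char_point T') \<in> {a<..<b}"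
      if "T' \<in> near_shape (of_real (1 - x)) ((4/5) ^ n)" "is_triangle T'" for T'
    proof -
      have "T' \<in> near_shape (of_real (1 - x)) \<delta>" using that(1) n by (fastforce simp: near_shape_def)
      from \<delta>(2)[OF this that(2)] show ?thesis by (auto simp: \<epsilon>_def)
    qed
    ultimately show ?thesis
      using reach_in_trans[OF tri[OF _ that], of _ "5 + n" _ 0] by auto
  qed
  then show ?thesis by blast
qed

section \<open>Recurrence\<close>

text \<open>Splits off the first choice instead of the last, as conditioning on the head of the
  stream demands.\<close>

lemma tri_chain_Stream: "tri_chain T (k ## \<omega>) (Suc n) = tri_chain (subdiv T k) \<omega> n"
  by (induction n) simp_all

lemma is_triangle_tri_chain: "is_triangle T \<Longrightarrow> is_triangle (tri_chain T \<omega> n)"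
  by (induction n) (auto intro: is_triangle_subdiv)

lemma tri_chain_stake: "tri_chain T \<omega> n = fold (\<lambda>k T. subdiv T k) (stake n \<omega>) T"
  by (induction n) (simp_all add: stake_Suc del: stake.simps(2))

text \<open>The state at time \<open>n\<close> is a function of a finite prefix, which takes values
  in a discrete space; so \<open>Q\<close> can be arbitrary.\<close>

lemma pred_tri_chain [measurable]: "Measurable.pred choice_space (\<lambda>\<omega>. Q (tri_chain T \<omega> n))"
proof -
  have "stake n \<in> measurable choice_space (count_space (UNIV :: nat list set))"
    unfolding choice_space_def
    using measurable_stake
    by (subst measurable_cong_sets[OF sets_stream_space_cong[of _ "count_space UNIV"] refl]) auto
  from measurable_compose[OF this, of "\<lambda>xs. Q (fold (\<lambda>k T. subdiv T k) xs T)" "count_space UNIV"]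
  show ?thesis unfolding tri_chain_stake by simp
qed

lemma prob_space_choice_space: "prob_space choice_space"
  unfolding choice_space_def by (rule prob_space.prob_space_stream_space[OF prob_space_measure_pmf])

lemma space_choice_space [simp]: "space choice_space = UNIV"
  by (simp add: choice_space_def space_stream_space)

section \<open>Probability of avoiding a set of triangles\<close>

definition avoid_prob :: "triangle set \<Rightarrow> triangle \<Rightarrow> real" where
  "avoid_prob G T = measure choice_space {\<omega>. \<forall>n. tri_chain T \<omega> n \<notin> G}"

text \<open>Conditioning on the first choice; an inequality, since the constraint at time 0 is
  dropped.\<close>

lemma avoid_prob_le: "avoid_prob G T \<le> (\<Sum>k<6. avoid_prob G (subdiv T k)) / 6"
proof -
  interpret prob_space choice_space by (rule prob_space_choice_space)
  let ?A = "\<lambda>T. {\<omega>. \<forall>n. tri_chain T \<omega> n \<notin> G}"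
  have A: "?A T \<in> sets choice_space" for T
  proof -
    have "{\<omega> \<in> space choice_space. \<forall>n. tri_chain T \<omega> n \<notin> G} \<in> sets choice_space" by measurable
    then show ?thesis by simp
  qed
  have sub: "{\<omega>. k ## \<omega> \<in> ?A T} \<subseteq> ?A (subdiv T k)" for k
  proof safe
    fix \<omega> n
    assume "\<forall>n. tri_chain T (k ## \<omega>) n \<notin> G" "tri_chain (subdiv T k) \<omega> n \<in> G"
    then show False using tri_chain_Stream by metis
  qed
  have "ennreal (avoid_prob G T) = emeasure choice_space (?A T)"
    by (simp add: avoid_prob_def emeasure_eq_measure)
  also have "\<dots> = (\<integral>\<^sup>+k. emeasure choice_space {\<omega>. k ## \<omega> \<in> ?A T} \<partial>measure_pmf (pmf_of_set {0..<6}))"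
    using prob_space.emeasure_stream_space[OF prob_space_measure_pmf, of "?A T" "pmf_of_set {0..<6}"] A
    by (simp add: choice_space_def space_stream_space)
  also have "\<dots> \<le> (\<integral>\<^sup>+k. ennreal (avoid_prob G (subdiv T k)) \<partial>measure_pmf (pmf_of_set {0..<6}))"
    unfolding avoid_prob_def emeasure_eq_measure[symmetric]
    by (intro nn_integral_mono emeasure_mono sub A)
  also have "\<dots> = (\<Sum>k\<in>{0..<6}. ennreal (avoid_prob G (subdiv T k))) / 6"
    by (subst nn_integral_pmf_of_set) auto
  also have "\<dots> = ennreal ((\<Sum>k<6. avoid_prob G (subdiv T k)) / 6)"
    by (subst sum_ennreal)
      (auto simp: avoid_prob_def sum_nonneg divide_ennreal[symmetric] atLeast0LessThan)
  finally show ?thesis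
    by (subst (asm) ennreal_le_iff) (auto simp: avoid_prob_def intro!: sum_nonneg divide_nonneg_nonneg)
qed

text \<open>One first choice follows the successful word and obeys the induction hypothesis; the
  other five are bounded by \<open>c\<close>. At \<open>n = 0\<close> the set is hit at once and
  both sides vanish.\<close>

lemma avoid_prob_bound:
  assumes "reach_in G n T" "is_triangle T"
    and c: "\<And>T. is_triangle T \<Longrightarrow> avoid_prob G T \<le> c"
  shows "avoid_prob G T \<le> (1 - (1/6) ^ n) * c"
  using assms(1,2)
proof (induction n arbitrary: T)
  case 0
  then have "tri_chain T \<omega> 0 \<in> G" for \<omega> by simp
  then have "{\<omega>. \<forall>n. tri_chain T \<omega> n \<notin> G} = {}" by blast
  then show ?case by (simp only: avoid_prob_def measure_empty) simp
next
  case (Suc n)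
  then obtain k where k: "k < 6" "reach_in G n (subdiv T k)" by auto
  have "(\<Sum>k<6. avoid_prob G (subdiv T k))
      = avoid_prob G (subdiv T k) + (\<Sum>j\<in>{..<6} - {k}. avoid_prob G (subdiv T j))"
    using k(1) by (simp add: sum.remove)
  also have "avoid_prob G (subdiv T k) \<le> (1 - (1/6) ^ n) * c"
    by (rule Suc.IH[OF k(2) is_triangle_subdiv[OF Suc.prems(2)]])
  also have "(\<Sum>j\<in>{..<6} - {k}. avoid_prob G (subdiv T j)) \<le> (\<Sum>j\<in>{..<6} - {k}. c)"
    using Suc.prems by (intro sum_mono c is_triangle_subdiv)
  also have "\<dots> = 5 * c" using k(1) by simp
  finally have "(\<Sum>k<6. avoid_prob G (subdiv T k)) \<le> (1 - (1/6) ^ n) * c + 5 * c" by simp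
  then have "6 * avoid_prob G T \<le> (1 - (1/6) ^ n) * c + 5 * c"
    using avoid_prob_le[of G T] by simp
  also have "\<dots> = 6 * ((1 - (1/6) ^ Suc n) * c)" by (simp add: algebra_simps)
  finally show ?case by simp
qed

text \<open>A uniform chance of hitting \<^term>\<open>G\<close> within \<^term>\<open>N\<close> steps gives, for the supremum
  \<^term>\<open>c\<close> of the avoidance probabilities, the inequality \<^term>\<open>c \<le> (1 - (1/6) ^ N) * c\<close>.\<close>

lemma AE_hits:
  assumes "\<And>T. is_triangle T \<Longrightarrow> reach_in G N T" "is_triangle T"
  shows "AE \<omega> in choice_space. \<exists>n. tri_chain T \<omega> n \<in> G"
proof -
  interpret prob_space choice_space by (rule prob_space_choice_space)
  define c where "c = (SUP T\<in>Collect is_triangle. avoid_prob G T)"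
  have "bdd_above (avoid_prob G ` Collect is_triangle)"
    by (auto simp: avoid_prob_def intro!: bdd_aboveI[of _ 1])
  then have c: "avoid_prob G T \<le> c" if "is_triangle T" for T
    unfolding c_def using that by (intro cSUP_upper) auto
  have "c \<le> (1 - (1/6) ^ N) * c"
    unfolding c_def
  proof (rule cSUP_least)
    show "Collect is_triangle \<noteq> {}" using assms(2) by blast
  qed (use avoid_prob_bound[OF assms(1) _ c] in \<open>auto simp: c_def\<close>)
  then have "(1/6) ^ N * c \<le> 0" by (simp add: algebra_simps)
  moreover have "(1/6::real) ^ N > 0" by simp
  ultimately have "c \<le> 0" by (simp add: mult_le_0_iff)
  then have "prob {\<omega>. \<forall>n. tri_chain T \<omega> n \<notin> G} = 0"
    using c[OF assms(2)] measure_nonneg[of choice_space "{\<omega>. \<forall>n. tri_chain T \<omega> n \<notin> G}"]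
    unfolding avoid_prob_def by linarith
  then have "emeasure choice_space {\<omega> \<in> space choice_space. \<not> (\<exists>n. tri_chain T \<omega> n \<in> G)} = 0"
    by (simp add: emeasure_eq_measure)
  then show ?thesis by (intro AE_I[OF subset_refl]) measurable
qed

text \<open>Hitting from time \<open>Suc m\<close> on becomes, after the first choice
  \<open>k\<close>, hitting from time \<open>m\<close> on when started at \<open>subdiv T k\<close>;
  hence the induction over all starting triangles.\<close>

lemma AE_hits_after:
  assumes "\<And>T. is_triangle T \<Longrightarrow> reach_in G N T" "is_triangle T"
  shows "AE \<omega> in choice_space. \<exists>n\<ge>m. tri_chain T \<omega> n \<in> G"
  using assms(2)
proof (induction m arbitrary: T)
  case 0
  then show ?case using AE_hits[OF assms(1)] by simp
next
  case (Suc m)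
  have "Measurable.pred choice_space (\<lambda>\<omega>. \<exists>n\<ge>Suc m. tri_chain T \<omega> n \<in> G)" by measurable
  from prob_space.AE_stream_space[OF prob_space_measure_pmf, OF this[unfolded choice_space_def]]
  have "(AE \<omega> in choice_space. \<exists>n\<ge>Suc m. tri_chain T \<omega> n \<in> G) \<longleftrightarrow>
      (AE k in pmf_of_set {0..<6}. AE \<omega> in choice_space. \<exists>n\<ge>Suc m. tri_chain T (k ## \<omega>) n \<in> G)"
    unfolding choice_space_def .
  moreover have "AE \<omega> in choice_space. \<exists>n\<ge>Suc m. tri_chain T (k ## \<omega>) n \<in> G" for k
    using Suc.IH[OF is_triangle_subdiv[OF Suc.prems, of k]]
    by (rule AE_mp) (intro AE_I2 impI, metis Suc_le_mono tri_chain_Stream)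
  ultimately show ?case by simp
qed

theorem theorem3:
  fixes T0 :: triangle
  assumes "is_triangle T0"
  shows "AE \<omega> in choice_space.
           (\<Inter>p. closure ((\<lambda>n. Re (char_point (tri_chain T0 \<omega> n))) ` {p..})) = {0..1/2::real}"
proof -
  \<comment> \<open>Rational endpoints leave countably many events, so one null set serves all
    intervals.\<close>
  have "AE \<omega> in choice_space. {real_of_rat a<..<real_of_rat b} \<inter> {0..1/2} \<noteq> {} \<longrightarrow>
      (\<exists>n\<ge>m. Re (char_point (tri_chain T0 \<omega> n)) \<in> {real_of_rat a<..<real_of_rat b})" for a b m
  proof (cases "{real_of_rat a<..<real_of_rat b} \<inter> {0..1/2} = {}")
    case False
    then obtain x where "x \<in> {real_of_rat a<..<real_of_rat b}" "x \<in> {0..1/2}" by blast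
    from reach_interval[OF this] obtain N where
      "\<And>T. is_triangle T \<Longrightarrow>
        reach_in {T. Re (char_point T) \<in> {real_of_rat a<..<real_of_rat b}} N T" by blast
    from AE_hits_after[OF this assms, of m] show ?thesis by simp
  qed simp
  then have "AE \<omega> in choice_space. \<forall>a b m.
      {real_of_rat a<..<real_of_rat b} \<inter> {0..1/2} \<noteq> {} \<longrightarrow>
      (\<exists>n\<ge>m. Re (char_point (tri_chain T0 \<omega> n)) \<in> {real_of_rat a<..<real_of_rat b})"
    by (simp only: AE_all_countable) blast
  then show ?thesis
  proof (rule AE_mp, intro AE_I2 impI)
    fix \<omega>
    let ?X = "\<lambda>n. Re (char_point (tri_chain T0 \<omega> n))"
    assume hit: "\<forall>a b m. {real_of_rat a<..<real_of_rat b} \<inter> {0..1/2} \<noteq> {} \<longrightarrow>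
      (\<exists>n\<ge>m. ?X n \<in> {real_of_rat a<..<real_of_rat b})"
    have "?X ` {0..} \<subseteq> {0..1/2}"
      using Re_char_point_range is_triangle_tri_chain[OF assms] by blast
    then have "closure (?X ` {0..}) \<subseteq> {0..1/2}" by (intro closure_minimal) auto
    then have "(\<Inter>p. closure (?X ` {p..})) \<subseteq> {0..1/2}" by blast
    moreover have "x \<in> closure (?X ` {p..})" if x: "x \<in> {0..1/2}" for x p
      unfolding closure_approachable
    proof (intro allI impI)
      fix e :: real
      assume "e > 0"
      then obtain a b where ab: "x - e < real_of_rat a" "real_of_rat a < x"
        "x < real_of_rat b" "real_of_rat b < x + e"
        using of_rat_dense[of "x - e" x] of_rat_dense[of x "x + e"] by auto
      then have "{real_of_rat a<..<real_of_rat b} \<inter> {0..1/2} \<noteq> {}" using x by fastforce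
      with hit obtain n where "n \<ge> p" "?X n \<in> {real_of_rat a<..<real_of_rat b}" by blast
      then show "\<exists>y\<in>?X ` {p..}. dist y x < e"
        using ab by (intro bexI[of _ "?X n"]) (auto simp: dist_real_def)
    qed
    ultimately show "(\<Inter>p. closure (?X ` {p..})) = {0..1/2}" by blast
  qed
qed

end
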